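(* For every $K\in\mathbb{N}$ and $\varepsilon>0$ there exists a weak-oracle single-pass streaming algorithm for maximizing a non-negative monotone submodular function $f\colon 2^E\to\mathbb{R}_+$ subject to $|S|\le K$ that achieves approximation ratio $\frac{K}{2K-1}-\varepsilon$ and uses $O\left(\frac{K 2^{2K}\log(K/\varepsilon)}{\varepsilon}\right)$ space.
   Context: A set function $f$ is submodular if $f(S\cup\{e\})-f(S)\ge f(T\cup\{e\})-f(T)$ for all $S\subseteq T\subsetneq E$, $e\in E\setminus T$, and monotone if $f(S)\le f(T)$ for $S\subseteq T$. The elements of $E$ arrive one by one in a stream, read once. The algorithm stores a set of elements and additional memory; when an element arrives it may update its stored elements and memory using function values of subsets of its stored elements together with the new element. In the weak oracle model the algorithm may only evaluate $f$ on feasible sets (here: sets of size at most $K$). Space is the number of stored words plus stored elements. Approximation ratio $\alpha$ means the output is feasible with value at least $\alpha\cdot\max_{|S|\le K} f(S)$. *)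

theory Defs
  imports Complex_Main "HOL-Library.FuncSet"
begin

definition submodular_on :: "'a set \<Rightarrow> ('a set \<Rightarrow> real) \<Rightarrow> bool" where
  "submodular_on E f \<longleftrightarrow>
     (\<forall>S T e. S \<subseteq> T \<and> T \<subset> E \<and> e \<in> E - T \<longrightarrow>
        f (S \<union> {e}) - f S \<ge> f (T \<union> {e}) - f T)"

definition monotone_set_fun_on :: "'a set \<Rightarrow> ('a set \<Rightarrow> real) \<Rightarrow> bool" where
  "monotone_set_fun_on E f \<longleftrightarrow> (\<forall>S T. S \<subseteq> T \<and> T \<subseteq> E \<longrightarrow> f S \<le> f T)"

definition nonneg_set_fun_on :: "'a set \<Rightarrow> ('a set \<Rightarrow> real) \<Rightarrow> bool" where
  "nonneg_set_fun_on E f \<longleftrightarrow> (\<forall>S. S \<subseteq> E \<longrightarrow> 0 \<le> f S)"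

definition feasible_sets :: "nat \<Rightarrow> 'a set \<Rightarrow> 'a set set" where
  "feasible_sets K X = {S. S \<subseteq> X \<and> finite S \<and> card S \<le> K}"

definition opt_value :: "nat \<Rightarrow> 'a set \<Rightarrow> ('a set \<Rightarrow> real) \<Rightarrow> real" where
  "opt_value K E f = Max (f ` feasible_sets K E)"

text \<open>A word holds a reference to a stored element, an oracle answer, or an integer. What may
  actually occur in a word is restricted by \<open>weak_oracle_streaming_alg\<close> (references and oracle
  answers) and by \<open>runs_in_space\<close> (size of integers), so that a single word cannot be used to
  encode an unbounded amount of data.\<close>

datatype 'a mem_word = Ref 'a | Val real | Num nat

record 'a stream_state =
  stored :: "'a set"
  memory :: "'a mem_word list"

definition space_used :: "'a stream_state \<Rightarrow> nat" where
  "space_used \<sigma> = card (stored \<sigma>) + length (memory \<sigma>)"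

text \<open>The first argument of \<open>update\<close> and \<open>final_output\<close> is the oracle; in a run it is always a
  restriction of the objective function, see \<open>weak_oracle\<close>.\<close>

record 'a stream_alg =
  init :: "'a stream_state"
  update :: "('a set \<Rightarrow> real) \<Rightarrow> 'a \<Rightarrow> 'a stream_state \<Rightarrow> 'a stream_state"
  final_output :: "('a set \<Rightarrow> real) \<Rightarrow> 'a stream_state \<Rightarrow> 'a set"

text \<open>The only access to \<open>f\<close> when the elements of \<open>X\<close> are at hand: outside of the feasible subsets
  of \<open>X\<close> the oracle carries no information on \<open>f\<close>.\<close>

definition weak_oracle :: "nat \<Rightarrow> ('a set \<Rightarrow> real) \<Rightarrow> 'a set \<Rightarrow> ('a set \<Rightarrow> real)" where
  "weak_oracle K f X = restrict f (feasible_sets K X)"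

text \<open>Elements can be stored only on arrival, and once dropped they are lost; references point to
  stored elements; a real number in memory is an answer that the oracle has given.\<close>

definition weak_oracle_streaming_alg :: "nat \<Rightarrow> 'a stream_alg \<Rightarrow> bool" where
  "weak_oracle_streaming_alg K A \<longleftrightarrow>
     stored (init A) = {} \<and>
     set (memory (init A)) \<subseteq> range Num \<and>
     (\<forall>orc e \<sigma>.
        stored (update A orc e \<sigma>) \<subseteq> insert e (stored \<sigma>) \<and>
        (\<forall>a. Ref a \<in> set (memory (update A orc e \<sigma>)) \<longrightarrow> a \<in> stored (update A orc e \<sigma>)) \<and>
        (\<forall>r. Val r \<in> set (memory (update A orc e \<sigma>)) \<longrightarrow>
           Val r \<in> set (memory \<sigma>) \<or> r \<in> orc ` feasible_sets K (insert e (stored \<sigma>)))) \<and>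
     (\<forall>orc \<sigma>. final_output A orc \<sigma> \<subseteq> stored \<sigma>)"

definition stream_step ::
  "nat \<Rightarrow> ('a set \<Rightarrow> real) \<Rightarrow> 'a stream_alg \<Rightarrow> 'a \<Rightarrow> 'a stream_state \<Rightarrow> 'a stream_state" where
  "stream_step K f A e \<sigma> = update A (weak_oracle K f (insert e (stored \<sigma>))) e \<sigma>"

definition state_after ::
  "nat \<Rightarrow> ('a set \<Rightarrow> real) \<Rightarrow> 'a stream_alg \<Rightarrow> 'a list \<Rightarrow> 'a stream_state" where
  "state_after K f A es = fold (stream_step K f A) es (init A)"

definition result ::
  "nat \<Rightarrow> ('a set \<Rightarrow> real) \<Rightarrow> 'a stream_alg \<Rightarrow> 'a list \<Rightarrow> 'a set" where
  "result K f A es =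
     (let \<sigma> = state_after K f A es in final_output A (weak_oracle K f (stored \<sigma>)) \<sigma>)"

text \<open>The ground set is \<open>set es\<close>, and \<open>es\<close> is its (arbitrary) order of arrival.\<close>

definition instance_stream :: "'a list \<Rightarrow> ('a set \<Rightarrow> real) \<Rightarrow> bool" where
  "instance_stream es f \<longleftrightarrow>
     distinct es \<and> nonneg_set_fun_on (set es) f \<and>
     monotone_set_fun_on (set es) f \<and> submodular_on (set es) f"

definition achieves_ratio :: "nat \<Rightarrow> real \<Rightarrow> 'a stream_alg \<Rightarrow> bool" where
  "achieves_ratio K \<alpha> A \<longleftrightarrow>
     (\<forall>es f. instance_stream es f \<longrightarrow>
        result K f A es \<in> feasible_sets K (set es) \<and>
        f (result K f A es) \<ge> \<alpha> * opt_value K (set es) f)"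

text \<open>Integers in memory are addresses and counters of logarithmic bit length: they are bounded by
  the space or by the length of the stream, whichever is larger.\<close>

definition runs_in_space :: "nat \<Rightarrow> real \<Rightarrow> 'a stream_alg \<Rightarrow> bool" where
  "runs_in_space K s A \<longleftrightarrow>
     (\<forall>es f. instance_stream es f \<longrightarrow>
        (\<forall>i \<le> length es. let \<sigma> = state_after K f A (take i es) in
           real (space_used \<sigma>) \<le> s \<and>
           (\<forall>n. Num n \<in> set (memory \<sigma>) \<longrightarrow> real n \<le> max s (real (length es)))))"

end

theory Submission
  imports Defs
begin

text \<open>Fix a guess \<open>v\<close> of the optimum and put \<open>\<tau> = v / (2K - 1)\<close>. Starting from \<open>T = {}\<close>, add an
  arriving element whenever \<open>|T| < K\<close> and its marginal value with respect to \<open>T\<close> is at least \<open>\<tau>\<close>,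
  and remember the best set \<open>T \<union> {x}\<close> ever evaluated. If \<open>T\<close> fills up, its value is at least \<open>K\<tau>\<close>.
  Otherwise look at the moment when the last element \<open>x\<close> of an optimal set \<open>O\<close> arrives: every other
  element of \<open>O\<close> is in \<open>T\<close> or has marginal value less than \<open>\<tau>\<close>, so
  \<open>f (T \<union> {x}) \<ge> f O - (K - 1)\<tau> \<ge> K\<tau>\<close> as soon as \<open>v \<le> f O\<close>.

  The guesses are the powers \<open>(1 + \<epsilon>)^j\<close>. If \<open>m\<close> is the largest singleton value so far, guesses
  below \<open>m / (1 + \<epsilon>)\<close> are useless, and for guesses above \<open>(2K - 1)m\<close> the set \<open>T\<close> is still empty.
  The remaining \<open>j\<close> form an interval of fixed length that is computed from \<open>m\<close>, so that the memory
  only has to list the sets \<open>T\<close> in the order of \<open>j\<close>.\<close>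

section \<open>The sieve for one threshold\<close>

definition sieve_step :: "nat \<Rightarrow> ('a set \<Rightarrow> real) \<Rightarrow> real \<Rightarrow> 'a \<Rightarrow> 'a list \<Rightarrow> 'a list" where
  "sieve_step K f \<tau> e T =
     (if length T < K \<and> f (set T) + \<tau> \<le> f (insert e (set T)) then T @ [e] else T)"

definition sieve :: "nat \<Rightarrow> ('a set \<Rightarrow> real) \<Rightarrow> real \<Rightarrow> 'a list \<Rightarrow> 'a list" where
  "sieve K f \<tau> es = fold (sieve_step K f \<tau>) es []"

lemma sieve_Nil [simp]: "sieve K f \<tau> [] = []"
  by (simp add: sieve_def)

lemma sieve_snoc [simp]: "sieve K f \<tau> (es @ [e]) = sieve_step K f \<tau> e (sieve K f \<tau> es)"
  by (simp add: sieve_def)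

lemma set_sieve_subset: "set (sieve K f \<tau> es) \<subseteq> set es"
  by (induction es rule: rev_induct) (auto simp: sieve_step_def)

lemma length_sieve_le: "length (sieve K f \<tau> es) \<le> K"
  by (induction es rule: rev_induct) (auto simp: sieve_step_def)

lemma sieve_append_mono: "set (sieve K f \<tau> us) \<subseteq> set (sieve K f \<tau> (us @ vs))"
proof (induction vs rule: rev_induct)
  case (snoc v vs)
  then show ?case
    by (auto simp: sieve_step_def simp flip: append_assoc)
qed simp

lemma length_sieve_append_mono: "length (sieve K f \<tau> us) \<le> length (sieve K f \<tau> (us @ vs))"
proof (induction vs rule: rev_induct)
  case (snoc v vs)
  then show ?case
    by (auto simp: sieve_step_def simp flip: append_assoc)
qed simp

lemma sieve_value_ge:
  assumes "0 \<le> f {}"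
  shows "real (length (sieve K f \<tau> es)) * \<tau> \<le> f (set (sieve K f \<tau> es))"
  by (induction es rule: rev_induct) (auto simp: assms sieve_step_def algebra_simps)

text \<open>At the last acceptance the final set is itself of the form \<open>T \<union> {y}\<close>
  with \<open>T\<close> not yet full. So the value of a full sieve is also the value of an evaluated
  candidate.\<close>

lemma sieve_last_acceptance:
  assumes "sieve K f \<tau> es \<noteq> []"
  obtains us y vs where "es = us @ y # vs" "length (sieve K f \<tau> us) < K"
    "set (sieve K f \<tau> es) = insert y (set (sieve K f \<tau> us))"
  using assms
proof (induction es arbitrary: thesis rule: rev_induct)
  case (snoc e es)
  show ?case
  proof (cases "sieve K f \<tau> (es @ [e]) = sieve K f \<tau> es")
    case True
    then obtain us y vs where "es = us @ y # vs" "length (sieve K f \<tau> us) < K"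
      "set (sieve K f \<tau> es) = insert y (set (sieve K f \<tau> us))"
      using snoc by metis
    then show ?thesis
      using snoc.prems(1)[of us y "vs @ [e]"] True by simp
  next
    case False
    then show ?thesis
      using snoc.prems(1)[of es e "[]"] by (auto simp: sieve_step_def split: if_splits)
  qed
qed simp

section \<open>Diminishing returns and the quality of the evaluated sets\<close>

locale monotone_submodular =
  fixes E :: "'a set" and f :: "'a set \<Rightarrow> real"
  assumes finite_ground: "finite E"
    and nonneg: "nonneg_set_fun_on E f"
    and monotone: "monotone_set_fun_on E f"
    and submodular: "submodular_on E f"
begin

lemma mono_le: "S \<subseteq> T \<Longrightarrow> T \<subseteq> E \<Longrightarrow> f S \<le> f T"
  using monotone by (auto simp: monotone_set_fun_on_def)

lemma nonneg_le: "S \<subseteq> E \<Longrightarrow> 0 \<le> f S"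
  using nonneg by (auto simp: nonneg_set_fun_on_def)

text \<open>Extends diminishing returns to \<open>e \<in> T\<close>: there the left side is zero and
  the right side is nonnegative by monotonicity.\<close>

lemma marginal_le:
  assumes "S \<subseteq> T" "T \<subseteq> E" "e \<in> E"
  shows "f (insert e T) - f T \<le> f (insert e S) - f S"
proof (cases "e \<in> T")
  case True
  then show ?thesis
    using mono_le[of S "insert e S"] assms by (auto simp: insert_absorb)
next
  case False
  then have "T \<subset> E" using assms by auto
  then show ?thesis
    using submodular False assms unfolding submodular_on_def by auto
qed

lemma union_le_sum_marginals:
  assumes "S \<subseteq> E" "O' \<subseteq> E" and bound: "\<And>x. x \<in> O' \<Longrightarrow> f (insert x S) - f S \<le> \<tau>"
  shows "f (S \<union> O') \<le> f S + real (card O') * \<tau>"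
proof -
  have "finite O'" using assms(2) finite_ground finite_subset by blast
  then show ?thesis
    using assms(2) bound
  proof (induction O' rule: finite_induct)
    case (insert x F)
    have "f (insert x (S \<union> F)) - f (S \<union> F) \<le> f (insert x S) - f S"
      using insert assms(1) by (intro marginal_le) auto
    also have "\<dots> \<le> \<tau>" using insert by auto
    finally show ?case using insert by (auto simp: algebra_simps)
  qed simp
qed

text \<open>Since the sieve is not full at the end, it was not full when \<open>x\<close> arrived.
  Hence \<open>x\<close> was either accepted, with marginal now zero, or rejected for a marginal
  below \<open>\<tau>\<close> over a smaller set.\<close>

lemma sieve_rejected_marginal:
  assumes "set us \<subseteq> E" "x \<in> set us" "length (sieve K f \<tau> us) < K" "0 \<le> \<tau>"
  shows "f (insert x (set (sieve K f \<tau> us))) - f (set (sieve K f \<tau> us)) \<le> \<tau>"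
proof -
  obtain as bs where us: "us = as @ x # bs"
    using assms(2) by (meson split_list)
  let ?A = "sieve K f \<tau> as" and ?U = "sieve K f \<tau> us"
  have us': "us = (as @ [x]) @ bs" using us by simp
  have len: "length ?A < K"
    using length_sieve_append_mono[of K f \<tau> as "x # bs"] assms(3) us by simp
  show ?thesis
  proof (cases "x \<in> set ?U")
    case True
    then show ?thesis using assms(4) by (simp add: insert_absorb)
  next
    case False
    then have "x \<notin> set (sieve K f \<tau> (as @ [x]))"
      using sieve_append_mono[of K f \<tau> "as @ [x]" bs] us' by auto
    then have "f (insert x (set ?A)) - f (set ?A) < \<tau>"
      using len by (auto simp: sieve_step_def split: if_splits)
    moreover have "f (insert x (set ?U)) - f (set ?U) \<le> f (insert x (set ?A)) - f (set ?A)"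
      using sieve_append_mono[of K f \<tau> as "x # bs"] us set_sieve_subset[of K f \<tau> us] assms
      by (intro marginal_le) auto
    ultimately show ?thesis by simp
  qed
qed

text \<open>The good set extends a sieve of size below \<open>K\<close>, so it is feasible and the
  weak oracle may evaluate it.\<close>

lemma sieve_evaluates_good_set:
  assumes es: "set es \<subseteq> E" and O: "O' \<subseteq> set es" "O' \<noteq> {}" "card O' \<le> K"
    and \<tau>: "0 \<le> \<tau>" and opt: "(2 * real K - 1) * \<tau> \<le> f O'"
  obtains us x vs where "es = us @ x # vs" "length (sieve K f \<tau> us) < K"
    "real K * \<tau> \<le> f (insert x (set (sieve K f \<tau> us)))"
proof -
  have finO: "finite O'" using O(1) finite_subset by blast
  then have K: "K \<ge> 1" using O by (metis One_nat_def Suc_leI card_gt_0_iff le_trans)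
  \<comment> \<open>Splitting at the last element of \<open>O'\<close> puts all its other elements
    into \<open>us\<close>, where the sieve has already judged them.\<close>
  obtain us x vs where split: "es = us @ x # vs" "x \<in> O'" "\<forall>y\<in>set vs. y \<notin> O'"
    using split_list_last_prop[of es "\<lambda>y. y \<in> O'"] O by blast
  let ?U = "sieve K f \<tau> us"
  have UE: "set ?U \<subseteq> E" using set_sieve_subset[of K f \<tau> us] es split(1) by auto
  show thesis
  proof (cases "length ?U < K")
    case True
    let ?S = "insert x (set ?U)"
    have SE: "?S \<subseteq> E" using UE es split by auto
    have "f O' \<le> f (?S \<union> (O' - {x}))"
      using O es SE by (intro mono_le) auto
    also have "\<dots> \<le> f ?S + real (card (O' - {x})) * \<tau>"
    proof (rule union_le_sum_marginals[OF SE])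
      show "O' - {x} \<subseteq> E" using O es by auto
      fix y assume y: "y \<in> O' - {x}"
      then have "y \<in> set us" using O split by auto
      then have "f (insert y (set ?U)) - f (set ?U) \<le> \<tau>"
        using True \<tau> es split(1) by (intro sieve_rejected_marginal) auto
      moreover have "f (insert y ?S) - f ?S \<le> f (insert y (set ?U)) - f (set ?U)"
        using SE y O es by (intro marginal_le) auto
      ultimately show "f (insert y ?S) - f ?S \<le> \<tau>" by simp
    qed
    \<comment> \<open>The element \<open>x\<close> is already in \<open>?S\<close>, so only
      \<open>K - 1\<close> marginals are paid, and \<open>(2K - 1) - (K - 1) = K\<close> copies of
      \<open>\<tau>\<close> remain.\<close>
    also have "\<dots> \<le> f ?S + (real K - 1) * \<tau>"
    proof -
      have "real (card (O' - {x})) \<le> real K - 1"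
        using O(3) K split(2) finO by (simp add: card_Diff_singleton_if)
      then show ?thesis using \<tau> by (simp add: mult_right_mono)
    qed
    finally have "real K * \<tau> \<le> f ?S" using opt by (simp add: algebra_simps)
    then show thesis using that split(1) True by blast
  next
    case False
    then have full: "length ?U = K" using length_sieve_le[of K f \<tau> us] by simp
    then have "?U \<noteq> []" using K by auto
    then obtain as y bs where *: "us = as @ y # bs" "length (sieve K f \<tau> as) < K"
      "set ?U = insert y (set (sieve K f \<tau> as))"
      by (rule sieve_last_acceptance)
    have "real K * \<tau> \<le> f (set ?U)"
      using sieve_value_ge[of f K \<tau> us] full nonneg_le[of "{}"] by simp
    then show thesis using that[of as y "bs @ x # vs"] * split(1) by simp
  qed
qed

end

section \<open>Running the sieve for a window of guesses\<close>

primrec best :: "('a set \<Rightarrow> real) \<Rightarrow> 'a list \<Rightarrow> 'a list list \<Rightarrow> 'a list" where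
  "best f b [] = b"
| "best f b (c # cs) = best f (if f (set b) < f (set c) then c else b) cs"

lemma best_mem: "best f b cs = b \<or> best f b cs \<in> set cs"
  by (induction cs arbitrary: b) (auto split: if_splits)

lemma best_ge_start: "f (set b) \<le> f (set (best f b cs))"
proof (induction cs arbitrary: b)
  case (Cons c cs)
  show ?case
    using Cons[of c] Cons[of b] by auto
qed simp

lemma best_ge: "c \<in> set cs \<Longrightarrow> f (set c) \<le> f (set (best f b cs))"
proof (induction cs arbitrary: b)
  case (Cons d cs)
  show ?case
  proof (cases "c = d")
    case True
    then show ?thesis
      using best_ge_start[of f c cs] best_ge_start[of f b cs] by auto
  qed (use Cons in auto)
qed simp

lemma best_cong:
  assumes "f (set b) = g (set b)" "\<And>c. c \<in> set cs \<Longrightarrow> f (set c) = g (set c)"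
  shows "best f b cs = best g b cs"
  using assms by (induction cs arbitrary: b) auto

section \<open>Geometric guesses and the window fixed by the top value\<close>

definition guess :: "real \<Rightarrow> int \<Rightarrow> real" where
  "guess \<delta> j = (1 + \<delta>) powr real_of_int j"

definition threshold :: "nat \<Rightarrow> real \<Rightarrow> int \<Rightarrow> real" where
  "threshold K \<delta> j = guess \<delta> j / (2 * real K - 1)"

definition low :: "real \<Rightarrow> real \<Rightarrow> int" where
  "low \<delta> m = \<lfloor>log (1 + \<delta>) m\<rfloor>"

text \<open>Chosen so that \<open>(1 + \<delta>)^width\<close> is at least \<open>2K\<close>,
  slightly more than the factor \<open>2K - 1\<close> between a guess and its threshold.\<close>

definition width :: "nat \<Rightarrow> real \<Rightarrow> nat" where
  "width K \<delta> = nat \<lceil>log (1 + \<delta>) (2 * real K)\<rceil>"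

definition window :: "nat \<Rightarrow> real \<Rightarrow> real \<Rightarrow> int list" where
  "window K \<delta> m = [low \<delta> m .. low \<delta> m + int (width K \<delta>)]"

lemma length_window: "length (window K \<delta> m) = Suc (width K \<delta>)"
  by (simp add: window_def)

lemma guess_pos: "\<delta> > 0 \<Longrightarrow> guess \<delta> j > 0"
  by (simp add: guess_def)

lemma threshold_pos: "\<delta> > 0 \<Longrightarrow> K \<ge> 1 \<Longrightarrow> threshold K \<delta> j > 0"
  by (auto simp: threshold_def guess_pos)

lemma guess_le_iff: "\<delta> > 0 \<Longrightarrow> m > 0 \<Longrightarrow> guess \<delta> j \<le> m \<longleftrightarrow> j \<le> low \<delta> m"
  by (simp add: guess_def low_def le_floor_iff le_log_iff)

lemma guess_low_bounds:
  assumes "\<delta> > 0" "m > 0"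
  shows "guess \<delta> (low \<delta> m) \<le> m" "m < guess \<delta> (low \<delta> m + 1)"
  using guess_le_iff[OF assms, of "low \<delta> m"] guess_le_iff[OF assms, of "low \<delta> m + 1"] by auto

lemma guess_add: "\<delta> > 0 \<Longrightarrow> guess \<delta> (i + j) = guess \<delta> i * guess \<delta> j"
  by (simp add: guess_def powr_add)

lemma guess_mono: "\<delta> > 0 \<Longrightarrow> i \<le> j \<Longrightarrow> guess \<delta> i \<le> guess \<delta> j"
  by (simp add: guess_def)

lemma guess_width_ge:
  assumes "\<delta> > 0" "K \<ge> 1"
  shows "2 * real K \<le> guess \<delta> (int (width K \<delta>))"
proof -
  have "log (1 + \<delta>) (2 * real K) \<le> real (width K \<delta>)"
    unfolding width_def by linarith
  then show ?thesis
    using assms by (simp add: guess_def log_le_iff)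
qed

text \<open>The bound \<open>m < guess \<delta> (j + 1)\<close> excludes guesses below the window,
  so for \<open>m > 0\<close> an unlisted \<open>j\<close> lies above it. Its threshold exceeds
  every singleton value, which is why its sieve need not be stored.\<close>

lemma outside_window_threshold:
  assumes "\<delta> > 0" "K \<ge> 1" "0 \<le> m" "m < guess \<delta> (j + 1)" "j \<notin> set (window K \<delta> m)"
  shows "m < threshold K \<delta> j"
proof (cases "m = 0")
  case True
  then show ?thesis using assms threshold_pos by auto
next
  case False
  then have m: "m > 0" using assms by simp
  then have "low \<delta> m < j + 1" using guess_le_iff[OF assms(1) m, of "j + 1"] assms(4) by linarith
  then have j: "low \<delta> m + 1 + int (width K \<delta>) \<le> j" using assms(5) by (auto simp: window_def)
  have "m * (2 * real K - 1) \<le> m * (2 * real K)" using m by simp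
  also have "\<dots> < guess \<delta> (low \<delta> m + 1) * guess \<delta> (int (width K \<delta>))"
    using guess_low_bounds(2)[OF assms(1) m] guess_width_ge[OF assms(1,2)] m assms(2)
    by (intro mult_less_le_imp_less) auto
  also have "\<dots> \<le> guess \<delta> j"
    using guess_mono[OF assms(1) j] guess_add[OF assms(1)] by simp
  finally show ?thesis
    using assms(2) by (simp add: threshold_def field_simps)
qed

lemma window_guess:
  assumes "\<delta> > 0" "m > 0" "j \<in> set (window K \<delta> m)"
  shows "m < guess \<delta> (j + 1)"
  using guess_le_iff[OF assms(1,2), of "j + 1"] assms(3) by (auto simp: window_def)

text \<open>The default \<open>[]\<close> is the true sieve for guesses above the window. Guesses
  that have fallen below it are not looked up again.\<close>

definition row :: "nat \<Rightarrow> real \<Rightarrow> real \<Rightarrow> 'a list list \<Rightarrow> int \<Rightarrow> 'a list" where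
  "row K \<delta> m Ts j = (if j \<in> set (window K \<delta> m) then Ts ! nat (j - low \<delta> m) else [])"

lemma row_map_window:
  "row K \<delta> m (map T (window K \<delta> m)) j = (if j \<in> set (window K \<delta> m) then T j else [])"
  by (auto simp: row_def window_def)

lemma row_cases:
  assumes "length Ts = Suc (width K \<delta>)"
  shows "row K \<delta> m Ts j = [] \<or> row K \<delta> m Ts j \<in> set Ts"
  using assms by (auto simp: row_def window_def)

text \<open>A state consists of an element of largest value (as a list of length at most one), the best
  set evaluated so far, and the sets of the sieves in the current window.\<close>

type_synonym 'a sieve_state = "'a list \<times> 'a list \<times> 'a list list"

definition top_elem :: "('a set \<Rightarrow> real) \<Rightarrow> 'a \<Rightarrow> 'a list \<Rightarrow> 'a list" where
  "top_elem f e p = (if f (set p) < f {e} then [e] else p)"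

text \<open>The candidate \<open>[e]\<close> stands for all sieves above the window: they are empty,
  so each of them would evaluate \<open>{e}\<close>.\<close>

definition window_step ::
  "nat \<Rightarrow> real \<Rightarrow> ('a set \<Rightarrow> real) \<Rightarrow> 'a \<Rightarrow> 'a sieve_state \<Rightarrow> 'a sieve_state" where
  "window_step K \<delta> f e = (\<lambda>(p, b, Ts).
     let p' = top_elem f e p;
         js = window K \<delta> (f (set p'));
         T = row K \<delta> (f (set p)) Ts
     in (p',
         best f b ([e] # map (\<lambda>j. T j @ [e]) (filter (\<lambda>j. length (T j) < K) js)),
         map (\<lambda>j. sieve_step K f (threshold K \<delta> j) e (T j)) js))"

fun rows_of :: "'a sieve_state \<Rightarrow> 'a list list" where
  "rows_of (p, b, Ts) = p # b # Ts"

text \<open>The number of rows is that of the \<open>width + 1\<close> sieves plus the two rows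
  \<open>p\<close> and \<open>b\<close>.\<close>

definition state_bounded :: "nat \<Rightarrow> real \<Rightarrow> 'a set \<Rightarrow> 'a sieve_state \<Rightarrow> bool" where
  "state_bounded K \<delta> X s \<longleftrightarrow> length (rows_of s) = width K \<delta> + 3 \<and>
     (\<forall>xs\<in>set (rows_of s). set xs \<subseteq> X \<and> length xs \<le> K)"

text \<open>A sieve is extended for evaluation only when it has fewer than \<open>K\<close>
  elements. Hence every query is a feasible set, and a weak oracle is as good as
  \<open>f\<close>.\<close>

lemma window_step_cong:
  assumes orc: "\<And>S. S \<in> feasible_sets K (insert e X) \<Longrightarrow> g S = f S"
    and s: "state_bounded K \<delta> X s" and K: "K \<ge> 1"
  shows "window_step K \<delta> g e s = window_step K \<delta> f e s"
proof -
  obtain p b Ts where [simp]: "s = (p, b, Ts)" by (cases s)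
  have fX: "g (set xs) = f (set xs)" if "set xs \<subseteq> insert e X" "length xs \<le> K" for xs
    using that card_length[of xs] by (intro orc) (auto simp: feasible_sets_def)
  have p: "g (set p) = f (set p)" and b: "g (set b) = f (set b)"
    using s by (auto simp: state_bounded_def intro!: fX)
  have e: "g {e} = f {e}" using fX[of "[e]"] K by simp
  have top: "top_elem g e p = top_elem f e p" "g (set (top_elem f e p)) = f (set (top_elem f e p))"
    using p e by (auto simp: top_elem_def)
  let ?T = "row K \<delta> (f (set p)) Ts"
  have T: "set (?T j) \<subseteq> X \<and> length (?T j) \<le> K" for j
    using row_cases[of Ts K \<delta> "f (set p)" j] s by (auto simp: state_bounded_def)
  have Te: "g (insert e (set (?T j))) = f (insert e (set (?T j)))" if "length (?T j) < K" for j
    using fX[of "?T j @ [e]"] T[of j] that by auto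
  have sieve: "sieve_step K g \<tau> e (?T j) = sieve_step K f \<tau> e (?T j)" for \<tau> j
    using Te[of j] fX[OF subset_insertI2, of "?T j"] T[of j] by (auto simp: sieve_step_def)
  show ?thesis
    by (auto simp: window_step_def Let_def top p sieve Te e b intro!: best_cong)
qed

lemma window_step_bounded:
  assumes s: "state_bounded K \<delta> X s" and K: "K \<ge> 1"
  shows "state_bounded K \<delta> (insert e X) (window_step K \<delta> f e s)"
proof -
  obtain p b Ts where [simp]: "s = (p, b, Ts)" by (cases s)
  let ?T = "row K \<delta> (f (set p)) Ts"
  let ?ok = "\<lambda>xs. set xs \<subseteq> insert e X \<and> length xs \<le> K"
  have T: "set (?T j) \<subseteq> X \<and> length (?T j) \<le> K" for j
    using row_cases[of Ts K \<delta> "f (set p)" j] s by (auto simp: state_bounded_def)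
  have 1: "?ok (top_elem f e p)"
    using s K by (auto simp: top_elem_def state_bounded_def)
  have 2: "?ok (sieve_step K f \<tau> e (?T j))" for \<tau> j
    using T[of j] by (auto simp: sieve_step_def)
  have 3: "?ok (best f b ([e] # map (\<lambda>j. ?T j @ [e]) (filter (\<lambda>j. length (?T j) < K) js)))" for js
    using best_mem[of f b "[e] # map (\<lambda>j. ?T j @ [e]) (filter (\<lambda>j. length (?T j) < K) js)"] T s K
    by (fastforce simp: state_bounded_def simp del: best.simps)
  show ?thesis
    using 1 2 3 length_window[of K \<delta>]
    by (auto simp: state_bounded_def window_step_def Let_def simp del: best.simps)
qed

text \<open>Initialization has no oracle. This is harmless because the window length does not depend
  on \<open>m\<close> and all sieves start empty; the top value is then \<open>f {}\<close>.\<close>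

definition initial_state :: "nat \<Rightarrow> real \<Rightarrow> 'a sieve_state" where
  "initial_state K \<delta> = ([], [], replicate (Suc (width K \<delta>)) [])"

lemma initial_state_bounded: "state_bounded K \<delta> {} (initial_state K \<delta>)"
  by (auto simp: state_bounded_def initial_state_def)

section \<open>Correctness invariant and approximation guarantee\<close>

context monotone_submodular
begin

lemma sieve_Nil_if_large_threshold:
  assumes "\<And>x. x \<in> set es \<Longrightarrow> f {x} < \<tau>"
  shows "sieve K f \<tau> es = []"
  using assms
proof (induction es rule: rev_induct)
  case (snoc e es)
  then have "f {e} < \<tau>" "sieve K f \<tau> es = []" by auto
  then show ?case using nonneg_le[of "{}"] by (simp add: sieve_step_def)
qed simp

text \<open>The last clause covers all guesses not below the window, listed or not. The restriction
  on \<open>j\<close> tightens as the top value grows, so guesses may be dropped while the claim for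
  the others persists.\<close>

definition state_correct :: "nat \<Rightarrow> real \<Rightarrow> 'a list \<Rightarrow> 'a sieve_state \<Rightarrow> bool" where
  "state_correct K \<delta> es = (\<lambda>(p, b, Ts).
     set p \<subseteq> set es \<and> length p \<le> 1 \<and> (\<forall>x\<in>set es. f {x} \<le> f (set p)) \<and>
     Ts = map (\<lambda>j. sieve K f (threshold K \<delta> j) es) (window K \<delta> (f (set p))) \<and>
     f {} \<le> f (set b) \<and>
     (\<forall>j us x vs. f (set p) < guess \<delta> (j + 1) \<and> es = us @ x # vs \<and>
        length (sieve K f (threshold K \<delta> j) us) < K \<longrightarrow>
        f (insert x (set (sieve K f (threshold K \<delta> j) us))) \<le> f (set b)))"

lemma initial_state_correct: "state_correct K \<delta> [] (initial_state K \<delta>)"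
  using length_window[of K \<delta> "f {}"]
  by (auto simp: state_correct_def initial_state_def map_replicate_const simp del: replicate_Suc)

text \<open>The window may move up. A guess in the new window was in the old one or above it; in the
  latter case its sieve is still empty, so starting it now loses nothing.\<close>

lemma window_step_correct:
  assumes \<delta>: "\<delta> > 0" and K: "K \<ge> 1" and E: "set (es @ [e]) \<subseteq> E"
    and s: "state_correct K \<delta> es s"
  shows "state_correct K \<delta> (es @ [e]) (window_step K \<delta> f e s)"
proof -
  obtain p b Ts where s_eq [simp]: "s = (p, b, Ts)" by (cases s)
  define m where "m = f (set p)"
  define p' where "p' = top_elem f e p"
  define m' where "m' = f (set p')"
  define T where "T = row K \<delta> m Ts"
  define cs where "cs = [e] # map (\<lambda>j. T j @ [e]) (filter (\<lambda>j. length (T j) < K) (window K \<delta> m'))"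
  define b' where "b' = best f b cs"
  let ?S = "\<lambda>j. sieve K f (threshold K \<delta> j)"
  have p: "set p \<subseteq> set es" "length p \<le> 1" "\<And>x. x \<in> set es \<Longrightarrow> f {x} \<le> m"
    and Ts: "Ts = map (\<lambda>j. ?S j es) (window K \<delta> m)"
    and b: "f {} \<le> f (set b)"
    and seen: "\<And>j us x vs. m < guess \<delta> (j + 1) \<Longrightarrow> es = us @ x # vs \<Longrightarrow> length (?S j us) < K \<Longrightarrow>
      f (insert x (set (?S j us))) \<le> f (set b)"
    using s by (auto simp: state_correct_def m_def)
  have m0: "0 \<le> m" using p(1) E unfolding m_def by (intro nonneg_le) auto
  have mm': "m \<le> m'" and em': "f {e} \<le> m'"
    by (auto simp: m_def m'_def p'_def top_elem_def)
  have zero: "m' = 0 \<Longrightarrow> m = 0" using mm' m0 by simp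
  have T_eq: "T j = ?S j es" if j: "m < guess \<delta> (j + 1) \<or> j \<in> set (window K \<delta> m)" for j
  proof (cases "j \<in> set (window K \<delta> m)")
    case True
    then show ?thesis by (simp add: T_def Ts row_map_window)
  next
    case False
    then have "m < threshold K \<delta> j"
      using j by (intro outside_window_threshold[OF \<delta> K m0]) auto
    then have "?S j es = []"
      using p(3) by (intro sieve_Nil_if_large_threshold) force
    then show ?thesis using False by (simp add: T_def Ts row_map_window)
  qed
  have T_win: "T j = ?S j es" if "j \<in> set (window K \<delta> m')" for j
  \<comment> \<open>For \<open>m' = 0\<close> the logarithm says nothing about the window, but then
    \<open>m = 0\<close> as well and the two windows coincide.\<close>
  proof (cases "m' = 0")
    case True
    then show ?thesis using zero that T_eq by auto
  next
    case False
    then have "m < guess \<delta> (j + 1)"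
      using window_guess[OF \<delta> _ that] mm' m0 by linarith
    then show ?thesis using T_eq by blast
  qed
  have step: "window_step K \<delta> f e s =
      (p', b', map (\<lambda>j. sieve_step K f (threshold K \<delta> j) e (T j)) (window K \<delta> m'))"
    by (simp add: window_step_def Let_def p'_def m'_def T_def m_def b'_def cs_def)
  have bb': "f (set b) \<le> f (set b')" by (simp add: b'_def best_ge_start)
  have seen': "f (insert x (set (?S j us))) \<le> f (set b')"
    if j: "m' < guess \<delta> (j + 1)" and split: "es @ [e] = us @ x # vs"
      and len: "length (?S j us) < K" for j us x vs
  \<comment> \<open>If \<open>vs\<close> is empty, the candidate is formed with the new element
    \<open>e\<close>; otherwise it was formed earlier and is covered by the old invariant.\<close>
  proof (cases vs rule: rev_cases)
    case Nil
    then have [simp]: "us = es" "x = e" using split by auto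
    show ?thesis
    proof (cases "j \<in> set (window K \<delta> m')")
      case True
      then have "?S j es @ [e] \<in> set cs" using len T_win[OF True] True by (force simp: cs_def)
      from best_ge[OF this, of f b] show ?thesis by (simp add: b'_def)
    next
      case False
      then have "m' < threshold K \<delta> j"
        using j mm' m0 by (intro outside_window_threshold[OF \<delta> K]) auto
      then have "?S j es = []"
        using p(3) mm' by (intro sieve_Nil_if_large_threshold) force
      moreover have "f (set [e]) \<le> f (set b')"
        unfolding b'_def by (rule best_ge) (simp add: cs_def)
      ultimately show ?thesis by simp
    qed
  next
    case (snoc ws w)
    then have "es = us @ x # ws" using split by auto
    then show ?thesis using seen[of j us x ws] j mm' len bb' by force
  qed
  have 1: "set p' \<subseteq> set (es @ [e])" "length p' \<le> 1"
    using p by (auto simp: p'_def top_elem_def)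
  have 3: "f {x} \<le> m'" if "x \<in> set (es @ [e])" for x
    using that p(3)[of x] mm' em' by auto
  have 2: "map (\<lambda>j. sieve_step K f (threshold K \<delta> j) e (T j)) (window K \<delta> m') =
      map (\<lambda>j. ?S j (es @ [e])) (window K \<delta> m')"
    using T_win by simp
  show ?thesis
    unfolding step state_correct_def prod.case
    using 1 2 3 b bb' seen' by (auto simp flip: m'_def)
qed

text \<open>The largest guess not exceeding \<open>f O'\<close> is within a factor
  \<open>1 + \<delta>\<close> of it. As \<open>K / (2K - 1) \<le> 1\<close>, this rounding costs at
  most \<open>\<delta> * f O'\<close>.\<close>

lemma state_correct_approx:
  assumes \<delta>: "\<delta> > 0" and K: "K \<ge> 1" and es: "set es \<subseteq> E"
    and s: "state_correct K \<delta> es (p, b, Ts)"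
    and O: "O' \<in> feasible_sets K (set es)"
    and opt: "\<And>S. S \<in> feasible_sets K (set es) \<Longrightarrow> f S \<le> f O'"
  shows "(real K / (2 * real K - 1) - \<delta>) * f O' \<le> f (set b)"
proof -
  have b: "f {} \<le> f (set b)" using s by (simp add: state_correct_def)
  have O0: "0 \<le> f O'" using O es by (intro nonneg_le) (auto simp: feasible_sets_def)
  have ratio: "real K / (2 * real K - 1) \<le> 1" using K by (simp add: field_simps)
  consider "f O' = 0" | "f O' > 0" "O' = {}" | "f O' > 0" "O' \<noteq> {}" using O0 by linarith
  then show ?thesis
  proof cases
    case 1
    then show ?thesis using b nonneg_le[of "{}"] by simp
  next
    case 2
    have "(real K / (2 * real K - 1) - \<delta>) * f O' \<le> 1 * f O'"
      using ratio \<delta> O0 by (intro mult_right_mono) auto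
    then show ?thesis using b 2(2) by (metis mult_1 order_trans)
  next
    case 3
    define j where "j = low \<delta> (f O')"
    let ?\<tau> = "threshold K \<delta> j"
    have j: "guess \<delta> j \<le> f O'" "f O' < guess \<delta> (j + 1)"
      using guess_low_bounds[OF \<delta> 3(1)] by (auto simp: j_def)
    \<comment> \<open>The top element is itself feasible because \<open>K \<ge> 1\<close>, so the
      chosen guess cannot lie below the window.\<close>
    have "f (set p) \<le> f O'"
      using s K card_length[of p] by (intro opt) (auto simp: state_correct_def feasible_sets_def)
    then have active: "f (set p) < guess \<delta> (j + 1)" using j by simp
    have \<tau>: "(2 * real K - 1) * ?\<tau> = guess \<delta> j" using K by (simp add: threshold_def)
    have "O' \<subseteq> set es" "card O' \<le> K" using O by (auto simp: feasible_sets_def)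
    moreover have "0 \<le> ?\<tau>" using threshold_pos[OF \<delta> K, of j] by simp
    moreover have "(2 * real K - 1) * ?\<tau> \<le> f O'" using \<tau> j by simp
    ultimately obtain us x vs where "es = us @ x # vs" "length (sieve K f ?\<tau> us) < K"
      "real K * ?\<tau> \<le> f (insert x (set (sieve K f ?\<tau> us)))"
      using sieve_evaluates_good_set[OF es _ 3(2)] by metis
    then have good: "real K * ?\<tau> \<le> f (set b)"
      using s active unfolding state_correct_def prod.case by force
    define r where "r = real K / (2 * real K - 1)"
    have r: "0 \<le> r" "r \<le> 1" using ratio K by (auto simp: r_def)
    have "guess \<delta> (j + 1) = guess \<delta> j * (1 + \<delta>)"
      using guess_add[OF \<delta>, of j 1] \<delta> by (simp add: guess_def)
    then have "f O' - guess \<delta> j \<le> \<delta> * guess \<delta> j" using j by (simp add: algebra_simps)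
    also have "\<dots> \<le> \<delta> * f O'" using j \<delta> by simp
    finally have gap: "f O' - guess \<delta> j \<le> \<delta> * f O'" .
    have "r * (f O' - guess \<delta> j) \<le> 1 * (f O' - guess \<delta> j)"
      using r j by (intro mult_right_mono) auto
    then have "(r - \<delta>) * f O' \<le> r * guess \<delta> j"
      using gap by (simp add: algebra_simps)
    also have "\<dots> = real K * ?\<tau>" by (simp add: r_def threshold_def)
    finally show ?thesis using good by (simp add: r_def)
  qed
qed

end

section \<open>The streaming algorithm\<close>

text \<open>The terminator \<open>Num 0\<close> makes a concatenation of blocks uniquely decodable.
  No oracle answers are kept; values are queried again when needed.\<close>

definition block :: "'a list \<Rightarrow> 'a mem_word list" where
  "block xs = map Ref xs @ [Num 0]"

definition encode :: "'a list list \<Rightarrow> 'a mem_word list" where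
  "encode xss = concat (map block xss)"

lemma block_append_inject: "block xs @ u = block ys @ v \<longleftrightarrow> xs = ys \<and> u = v"
proof (induction xs arbitrary: ys)
  case Nil
  then show ?case by (cases ys) (auto simp: block_def)
next
  case (Cons x xs)
  then show ?case by (cases ys) (auto simp: block_def)
qed

lemma inj_encode: "inj encode"
proof (rule injI)
  fix xss yss :: "'a list list"
  show "encode xss = encode yss \<Longrightarrow> xss = yss"
  proof (induction xss arbitrary: yss)
    case Nil
    then show ?case by (cases yss) (auto simp: encode_def block_def)
  next
    case (Cons xs xss)
    then obtain ys yss' where yss: "yss = ys # yss'"
      by (cases yss) (auto simp: encode_def block_def)
    then have "xs = ys" "encode xss = encode yss'"
      using Cons.prems by (auto simp: encode_def block_append_inject)
    then show ?case using Cons.IH yss by simp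
  qed
qed

lemma inj_rows_of: "inj rows_of"
  by (rule injI) (metis list.inject rows_of.elims)

definition decode :: "'a mem_word list \<Rightarrow> 'a sieve_state" where
  "decode = inv (encode \<circ> rows_of)"

lemma decode_encode [simp]: "decode (encode (rows_of s)) = s"
  using inv_f_f[OF inj_compose[OF inj_encode inj_rows_of], of s] by (simp add: decode_def)

text \<open>Junk memory contents may decode to references to elements that are not at hand. These are
  filtered out; in an actual run the filter does nothing.\<close>

definition pack :: "'a set \<Rightarrow> 'a list list \<Rightarrow> 'a stream_state" where
  "pack X xss = (let yss = map (filter (\<lambda>x. x \<in> X)) xss
     in \<lparr>stored = \<Union> (set ` set yss), memory = encode yss\<rparr>)"

lemma set_encode: "set (encode xss) \<subseteq> Ref ` \<Union> (set ` set xss) \<union> {Num 0}"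
  by (auto simp: encode_def block_def)

lemma stored_pack: "stored (pack X xss) \<subseteq> X"
  by (auto simp: pack_def Let_def)

lemma memory_pack: "set (memory (pack X xss)) \<subseteq> Ref ` stored (pack X xss) \<union> {Num 0}"
  using set_encode[of "map (filter (\<lambda>x. x \<in> X)) xss"] by (simp add: pack_def Let_def)

lemma pack_subset:
  assumes "\<And>xs. xs \<in> set xss \<Longrightarrow> set xs \<subseteq> X"
  shows "pack X xss = \<lparr>stored = \<Union> (set ` set xss), memory = encode xss\<rparr>"
proof -
  have "map (filter (\<lambda>x. x \<in> X)) xss = xss"
    using assms by (intro map_idI) (auto simp: filter_id_conv)
  then show ?thesis by (simp add: pack_def)
qed

definition sieve_alg :: "nat \<Rightarrow> real \<Rightarrow> 'a stream_alg" where
  "sieve_alg K \<delta> =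
    \<lparr>init = pack {} (rows_of (initial_state K \<delta>)),
     update = (\<lambda>orc e \<sigma>.
       pack (insert e (stored \<sigma>)) (rows_of (window_step K \<delta> orc e (decode (memory \<sigma>))))),
     final_output = (\<lambda>orc \<sigma>. set (fst (snd (decode (memory \<sigma>)))) \<inter> stored \<sigma>)\<rparr>"

text \<open>Legality is demanded for arbitrary states and oracles, not only reachable ones. The
  filter in \<open>pack\<close> secures the references, and no \<open>Val\<close> is ever
  written.\<close>

lemma weak_oracle_sieve_alg: "weak_oracle_streaming_alg K (sieve_alg K \<delta>)"
proof -
  have refs: "a \<in> stored (pack X xss)" if "Ref a \<in> set (memory (pack X xss))"
    for a :: 'a and X xss
    using memory_pack[of X xss] that by auto
  have vals: "Val r \<notin> set (memory (pack X xss))" for r and X :: "'a set" and xss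
    using memory_pack[of X xss] by auto
  have "stored (init (sieve_alg K \<delta>)) = {}"
    using stored_pack by (fastforce simp: sieve_alg_def)
  moreover from this have "set (memory (init (sieve_alg K \<delta>))) \<subseteq> range Num"
    using memory_pack[of "{}" "rows_of (initial_state K \<delta>)"] by (auto simp: sieve_alg_def)
  ultimately show ?thesis
    unfolding weak_oracle_streaming_alg_def
    using refs vals by (simp add: sieve_alg_def stored_pack)
qed

definition state_of :: "'a sieve_state \<Rightarrow> 'a stream_state" where
  "state_of s = \<lparr>stored = \<Union> (set ` set (rows_of s)), memory = encode (rows_of s)\<rparr>"

text \<open>Narrows the bound from the prefix read to the elements actually stored, since the oracle
  answers only on those and the new element.\<close>

lemma state_bounded_stored:
  "state_bounded K \<delta> X s \<Longrightarrow> state_bounded K \<delta> (stored (state_of s)) s"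
  by (auto simp: state_bounded_def state_of_def)

lemma pack_state_of:
  "state_bounded K \<delta> X s \<Longrightarrow> pack X (rows_of s) = state_of s"
  unfolding state_of_def by (rule pack_subset) (auto simp: state_bounded_def)

lemma stream_step_sieve_alg:
  assumes "state_bounded K \<delta> X s" "K \<ge> 1"
  shows "stream_step K f (sieve_alg K \<delta>) e (state_of s) = state_of (window_step K \<delta> f e s)"
proof -
  let ?X = "stored (state_of s)"
  have s: "state_bounded K \<delta> ?X s" using assms(1) by (rule state_bounded_stored)
  have "window_step K \<delta> (weak_oracle K f (insert e ?X)) e s = window_step K \<delta> f e s"
    using s assms(2) by (intro window_step_cong) (auto simp: weak_oracle_def)
  moreover have "decode (memory (state_of s)) = s" by (simp add: state_of_def)
  ultimately show ?thesis
    using pack_state_of[OF window_step_bounded[OF s assms(2)]]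
    by (simp add: stream_step_def sieve_alg_def)
qed

lemma (in monotone_submodular) state_after_sieve_alg:
  assumes "\<delta> > 0" "K \<ge> 1" "set es \<subseteq> E"
  obtains s where "state_after K f (sieve_alg K \<delta>) es = state_of s"
    "state_bounded K \<delta> (set es) s" "state_correct K \<delta> es s"
  using assms(3)
proof (induction es arbitrary: thesis rule: rev_induct)
  case Nil
  have "state_after K f (sieve_alg K \<delta>) [] = state_of (initial_state K \<delta>)"
    by (simp add: state_after_def sieve_alg_def pack_state_of[OF initial_state_bounded])
  then show ?case
    by (rule Nil.prems(1)) (simp_all add: initial_state_bounded initial_state_correct)
next
  case (snoc e es)
  then obtain s where s: "state_after K f (sieve_alg K \<delta>) es = state_of s"
    "state_bounded K \<delta> (set es) s" "state_correct K \<delta> es s" by auto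
  show ?case
  proof (rule snoc.prems(1))
    show "state_after K f (sieve_alg K \<delta>) (es @ [e]) = state_of (window_step K \<delta> f e s)"
      using s(1) stream_step_sieve_alg[OF s(2) assms(2)] by (simp add: state_after_def)
    show "state_bounded K \<delta> (set (es @ [e])) (window_step K \<delta> f e s)"
      using window_step_bounded[OF s(2) assms(2)] by simp
    show "state_correct K \<delta> (es @ [e]) (window_step K \<delta> f e s)"
      using window_step_correct[OF assms(1,2) snoc.prems(2) s(3)] .
  qed
qed

section \<open>Approximation ratio of the algorithm\<close>

lemma instance_stream_monotone_submodular:
  "instance_stream es f \<Longrightarrow> monotone_submodular (set es) f"
  by (simp add: instance_stream_def monotone_submodular_def)

lemma finite_feasible_sets: "finite X \<Longrightarrow> finite (feasible_sets K X)"
  by (rule finite_subset[of _ "Pow X"]) (auto simp: feasible_sets_def)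

lemma empty_feasible: "{} \<in> feasible_sets K X"
  by (simp add: feasible_sets_def)

lemma opt_value_attained:
  assumes "finite X"
  obtains S where "S \<in> feasible_sets K X" "opt_value K X f = f S"
    "\<And>S'. S' \<in> feasible_sets K X \<Longrightarrow> f S' \<le> f S"
proof -
  have fin: "finite (f ` feasible_sets K X)" "f ` feasible_sets K X \<noteq> {}"
    using finite_feasible_sets[OF assms] empty_feasible by auto
  from Max_in[OF this] obtain S where "S \<in> feasible_sets K X" "opt_value K X f = f S"
    by (auto simp: opt_value_def)
  then show thesis
    using that[of S] Max_ge[OF fin(1)] by (auto simp: opt_value_def)
qed

lemma achieves_ratio_sieve_alg:
  assumes \<delta>: "\<delta> > 0" and K: "K \<ge> 1"
  shows "achieves_ratio K (real K / (2 * real K - 1) - \<delta>) (sieve_alg K \<delta>)"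
  unfolding achieves_ratio_def
proof (intro allI impI)
  fix es :: "'a list" and f
  assume "instance_stream es f"
  then interpret monotone_submodular "set es" f by (rule instance_stream_monotone_submodular)
  obtain s where s: "state_after K f (sieve_alg K \<delta>) es = state_of s"
    "state_bounded K \<delta> (set es) s" "state_correct K \<delta> es s"
    using state_after_sieve_alg[OF \<delta> K order.refl] .
  obtain p b Ts where s_eq: "s = (p, b, Ts)" by (cases s)
  have res: "result K f (sieve_alg K \<delta>) es = set b"
  proof -
    have "decode (memory (state_of s)) = s" by (simp add: state_of_def)
    moreover have "set b \<subseteq> stored (state_of s)" by (auto simp: state_of_def s_eq)
    ultimately show ?thesis
      unfolding result_def Let_def s(1) by (auto simp: sieve_alg_def s_eq)
  qed
  have "set b \<in> feasible_sets K (set es)"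
    using s(2) card_length[of b] by (auto simp: s_eq state_bounded_def feasible_sets_def)
  moreover obtain S where "S \<in> feasible_sets K (set es)" "opt_value K (set es) f = f S"
    "\<And>S'. S' \<in> feasible_sets K (set es) \<Longrightarrow> f S' \<le> f S"
    using opt_value_attained[OF finite_set] by metis
  ultimately show "result K f (sieve_alg K \<delta>) es \<in> feasible_sets K (set es) \<and>
      (real K / (2 * real K - 1) - \<delta>) * opt_value K (set es) f \<le> f (result K f (sieve_alg K \<delta>) es)"
    using state_correct_approx[OF \<delta> K order.refl s(3)[unfolded s_eq]] res by auto
qed

section \<open>Space bound\<close>

lemma state_of_space:
  assumes "state_bounded K \<delta> X s"
  shows "space_used (state_of s) \<le> (width K \<delta> + 3) * (2 * K + 1)"
proof -
  \<comment> \<open>A row of at most \<open>K\<close> elements costs at most \<open>K\<close> stored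
    elements, \<open>K\<close> references and one terminator.\<close>
  have aux: "card (\<Union> (set ` set xss)) + length (encode xss) \<le> length xss * (2 * K + 1)"
    if "\<forall>xs\<in>set xss. length xs \<le> K" for xss :: "'a list list"
    using that
  proof (induction xss)
    case (Cons xs xss)
    have "card (set xs \<union> \<Union> (set ` set xss)) \<le> length xs + card (\<Union> (set ` set xss))"
      using card_Un_le[of "set xs" "\<Union> (set ` set xss)"] card_length[of xs] by linarith
    then show ?case using Cons by (fastforce simp: encode_def block_def)
  qed (simp add: encode_def)
  show ?thesis
    using aux[of "rows_of s"] assms by (simp add: state_bounded_def space_used_def state_of_def)
qed

text \<open>The crude estimate \<open>ln (2K) \<le> 2K\<close> is affordable because the target
  bound contains \<open>2 ^ (2 * K)\<close>.\<close>

lemma width_bound: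
  assumes "0 < \<epsilon>" "\<epsilon> < 1" "K \<ge> 1"
  shows "real (width K \<epsilon>) \<le> 4 * real K / \<epsilon> + 1"
proof -
  \<comment> \<open>Apply \<open>ln y \<le> y - 1\<close> at
    \<open>y = 1 / (1 + \<epsilon>)\<close>; then
    \<open>\<epsilon> / (1 + \<epsilon>) \<ge> \<epsilon> / 2\<close> as
    \<open>\<epsilon> < 1\<close>.\<close>
  have ln: "\<epsilon> / 2 \<le> ln (1 + \<epsilon>)"
  proof -
    have "1 - 1 / (1 + \<epsilon>) \<le> ln (1 + \<epsilon>)"
      using ln_le_minus_one[of "1 / (1 + \<epsilon>)"] assms by (simp add: ln_div)
    moreover have "\<epsilon> / 2 \<le> 1 - 1 / (1 + \<epsilon>)" using assms by (simp add: field_simps)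
    ultimately show ?thesis by linarith
  qed
  have lnK: "0 \<le> ln (2 * real K)" "ln (2 * real K) \<le> 2 * real K"
    using assms ln_bound[of "2 * real K"] by auto
  have "log (1 + \<epsilon>) (2 * real K) = ln (2 * real K) / ln (1 + \<epsilon>)" by (simp add: log_def)
  also have "\<dots> \<le> (2 * real K) / (\<epsilon> / 2)"
    using lnK ln assms by (intro frac_le) auto
  finally have le: "log (1 + \<epsilon>) (2 * real K) \<le> 4 * real K / \<epsilon>" by simp
  have "0 \<le> log (1 + \<epsilon>) (2 * real K)" using assms by simp
  then show ?thesis using le unfolding width_def by linarith
qed

lemma space_arith:
  assumes "0 < \<epsilon>" "\<epsilon> < 1" "K \<ge> 1"
  shows "real ((width K \<epsilon> + 3) * (2 * K + 1))
    \<le> 24 * (real K * 2 ^ (2 * K) * max 1 (ln (real K / \<epsilon>)) / \<epsilon>)"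
proof -
  have K4: "real K \<le> 2 ^ (2 * K)"
  proof -
    have "K \<le> 2 ^ (2 * K)" using less_exp[of "2 * K"] by linarith
    then show ?thesis by (metis of_nat_le_iff of_nat_numeral of_nat_power)
  qed
  have "real (width K \<epsilon> + 3) \<le> 4 * real K / \<epsilon> + 4" using width_bound[OF assms] by simp
  also have "\<dots> \<le> 4 * real K / \<epsilon> + 4 * real K / \<epsilon>"
  proof -
    have "\<epsilon> \<le> real K" using assms by linarith
    then show ?thesis using assms by (simp add: field_simps)
  qed
  finally have "real (width K \<epsilon> + 3) \<le> 8 * real K / \<epsilon>" by simp
  \<comment> \<open>Here \<open>2K + 1 \<le> 3K\<close>, giving the constant
    \<open>24 = 8 * 3\<close>. Afterwards one factor \<open>K\<close> is absorbed by
    \<open>2 ^ (2 * K)\<close> and the maximum is at least 1.\<close>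
  then have "real ((width K \<epsilon> + 3) * (2 * K + 1)) \<le> (8 * real K / \<epsilon>) * (3 * real K)"
    unfolding of_nat_mult using assms by (intro mult_mono) auto
  also have "\<dots> = 24 * (real K * real K * 1 / \<epsilon>)" by simp
  also have "\<dots> \<le> 24 * (real K * 2 ^ (2 * K) * max 1 (ln (real K / \<epsilon>)) / \<epsilon>)"
    using assms K4 by (intro mult_left_mono divide_right_mono mult_mono) auto
  finally show ?thesis .
qed

lemma runs_in_space_sieve_alg:
  assumes \<delta>: "\<delta> > 0" and K: "K \<ge> 1" and space: "real ((width K \<delta> + 3) * (2 * K + 1)) \<le> c"
  shows "runs_in_space K c (sieve_alg K \<delta>)"
  unfolding runs_in_space_def Let_def
proof (intro allI impI)
  fix es :: "'a list" and f i
  assume "instance_stream es f"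
  then interpret monotone_submodular "set es" f by (rule instance_stream_monotone_submodular)
  obtain s where s: "state_after K f (sieve_alg K \<delta>) (take i es) = state_of s"
    "state_bounded K \<delta> (set (take i es)) s"
    using state_after_sieve_alg[OF \<delta> K set_take_subset] by metis
  have "real (space_used (state_of s)) \<le> c"
    using state_of_space[OF s(2)] space by linarith
  moreover have "real n \<le> max c (real (length es))" if "Num n \<in> set (memory (state_of s))" for n
    using that set_encode[of "rows_of s"] by (auto simp: state_of_def)
  ultimately show "real (space_used (state_after K f (sieve_alg K \<delta>) (take i es))) \<le> c \<and>
    (\<forall>n. Num n \<in> set (memory (state_after K f (sieve_alg K \<delta>) (take i es))) \<longrightarrow>
      real n \<le> max c (real (length es)))"
    by (auto simp: s(1))
qed

section \<open>Degenerate parameters\<close>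

definition empty_alg :: "'a stream_alg" where
  "empty_alg = \<lparr>init = \<lparr>stored = {}, memory = []\<rparr>,
     update = (\<lambda>orc e \<sigma>. \<lparr>stored = {}, memory = []\<rparr>), final_output = (\<lambda>orc \<sigma>. {})\<rparr>"

lemma state_after_empty_alg: "state_after K f empty_alg es = \<lparr>stored = {}, memory = []\<rparr>"
  by (induction es rule: rev_induct) (auto simp: state_after_def empty_alg_def stream_step_def)

text \<open>The optimum is nonnegative, so a nonpositive ratio is met by the empty set in zero
  space.\<close>

lemma empty_alg_correct:
  assumes "\<alpha> \<le> 0" "0 \<le> c"
  shows "weak_oracle_streaming_alg K (empty_alg :: 'a stream_alg)"
    "achieves_ratio K \<alpha> (empty_alg :: 'a stream_alg)"
    "runs_in_space K c (empty_alg :: 'a stream_alg)"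
proof -
  show "weak_oracle_streaming_alg K (empty_alg :: 'a stream_alg)"
    by (simp add: weak_oracle_streaming_alg_def empty_alg_def)
  show "runs_in_space K c (empty_alg :: 'a stream_alg)"
    using assms(2) by (simp add: runs_in_space_def state_after_empty_alg space_used_def)
  show "achieves_ratio K \<alpha> (empty_alg :: 'a stream_alg)"
    unfolding achieves_ratio_def
  proof (intro allI impI)
    fix es :: "'a list" and f
    assume "instance_stream es f"
    then interpret monotone_submodular "set es" f by (rule instance_stream_monotone_submodular)
    have res: "result K f empty_alg es = {}" by (simp add: result_def empty_alg_def)
    obtain S where "S \<in> feasible_sets K (set es)" "opt_value K (set es) f = f S"
      using opt_value_attained[OF finite_set] by metis
    then have "0 \<le> opt_value K (set es) f"
      by (auto simp: feasible_sets_def intro: nonneg_le)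
    then have "\<alpha> * opt_value K (set es) f \<le> 0" using assms(1) by (simp add: mult_nonpos_nonneg)
    then show "result K f empty_alg es \<in> feasible_sets K (set es) \<and>
        \<alpha> * opt_value K (set es) f \<le> f (result K f empty_alg es)"
      using nonneg_le[of "{}"] empty_feasible by (simp add: res)
  qed
qed

theorem theorem1p4:
  "\<exists>C::real. \<forall>(K::nat) (\<epsilon>::real). \<epsilon> > 0 \<longrightarrow>
     (\<exists>A :: 'a stream_alg.
        weak_oracle_streaming_alg K A \<and>
        achieves_ratio K (real K / (2 * real K - 1) - \<epsilon>) A \<and>
        runs_in_space K (C * (real K * 2 ^ (2 * K) * max 1 (ln (real K / \<epsilon>)) / \<epsilon>)) A)"
proof (intro exI[of _ 24] allI impI)
  fix K :: nat and \<epsilon> :: real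
  assume \<epsilon>: "\<epsilon> > 0"
  \<comment> \<open>The constant 24 comes from \<open>space_arith\<close>.\<close>
  let ?c = "24 * (real K * 2 ^ (2 * K) * max 1 (ln (real K / \<epsilon>)) / \<epsilon>)"
  show "\<exists>A :: 'a stream_alg. weak_oracle_streaming_alg K A \<and>
    achieves_ratio K (real K / (2 * real K - 1) - \<epsilon>) A \<and> runs_in_space K ?c A"
  proof (cases "K \<ge> 1 \<and> \<epsilon> < 1")
    case True
    then show ?thesis
      using weak_oracle_sieve_alg achieves_ratio_sieve_alg[OF \<epsilon>, of K]
        runs_in_space_sieve_alg[OF \<epsilon> _ space_arith[OF \<epsilon>], of K] by blast
  next
    case False
    \<comment> \<open>Here the guarantee is vacuous, but the bound \<open>?c\<close> may leave no space at all.\<close>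
    then have "real K / (2 * real K - 1) - \<epsilon> \<le> 0"
    proof (cases "K = 0")
      case False
      then have "real K / (2 * real K - 1) \<le> 1" by (simp add: field_simps)
      moreover have "1 \<le> \<epsilon>" using \<open>\<not> (K \<ge> 1 \<and> \<epsilon> < 1)\<close> False by simp
      ultimately show ?thesis by linarith
    \<comment> \<open>For \<open>K = 0\<close> the fraction is \<open>0 / (-1) = 0\<close>.\<close>
    qed (use \<epsilon> in simp)
    moreover have "0 \<le> ?c" using \<epsilon> by simp
    ultimately show ?thesis using empty_alg_correct by blast
  qed
qed

end
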